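(* Let $f_\xi,g\in\mathbb{R}^{2^{K-1}-1}$ for some positive integer $K$. Let $R_{\max}$ be the prescribed max rank, used both for the max rank TT-SVD algorithm and for the QTT-FFT and QTT-iFFT algorithms. Then the computational complexity $C_{\text{QTT-conv}}$ of approximating the convolution $f_\xi*g$ by the QTT convolution algorithm with the max rank TT-SVD and max rank QTT-FFT algorithms (including the conversion of the vectors into the QTT format, the computation of the convolution in that format, and the conversion of the result back into a full vector) satisfies $$C_{\text{QTT-conv}}\le \mathcal{O}\big(R_{\max}^2\,2^K\big),$$ where the asymptotics is as $K\to\infty$ with $R_{\max}$ independent of $K$; that is, there is an absolute constant $C$ such that for each $R_{\max}$ the cost is at most $C R_{\max}^2 2^K$ for all sufficiently large $K$.
   Context: Notation. $|\mathcal{X}|$ is the number of entries of an array $\mathcal{X}$. $\mathrm{reshape}(\mathcal{X},[p_1,\dots,p_d])$ rearranges the entries of $\mathcal{X}$ in column-major order into a $p_1\times\cdots\times p_d$ array. A tensor $\mathcal{A}\in\mathbb{C}^{M_1\times\cdots\times M_K}$ is in tensor train (TT) format with TT-cores $\mathcal{A}^{(k)}\in\mathbb{C}^{r_{k-1}\times M_k\times r_k}$, $r_0=r_K=1$, if $\mathcal{A}(i_1,\dots,i_K)=A^{(1)}_{i_1}A^{(2)}_{i_2}\cdots A^{(K)}_{i_K}$, where $A^{(k)}_{i_k}=\mathcal{A}^{(k)}(:,i_k,:)\in\mathbb{C}^{r_{k-1}\times r_k}$; the $r_k$ are the TT-ranks. The quantized (QTT) format of a vector $v\in\mathbb{C}^{2^K}$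 is a TT format of the $K$-mode tensor $\mathcal{V}\in\mathbb{C}^{2\times\cdots\times2}$ given by $\mathcal{V}(i_1,\dots,i_K)=v(i)$, $i=\sum_{k=1}^K i_k2^{k-1}$, $i_k\in\{0,1\}$. The discrete convolution of $f_\xi,g\in\mathbb{R}^N$, $N=2^{K-1}-1$, is $I_j=\Delta x\sum_i (f_\xi)_i\, g_{j-i+\frac{N-1}{2}}$ for $j=0,\dots,N-1$ (sum over all indices $i$ giving legal subscripts), where $\Delta x>0$ is the grid step. It is obtained from a circular convolution after zero-padding $f_\xi$ and $g$ to length $2^K$. Max rank TT-SVD algorithm with max rank $R_{\max}$ (a positive integer), applied to $\mathcal{A}\in\mathbb{C}^{M_1\times\cdots\times M_K}$ (here all $M_k=2$). Set $r_0:=1$. For $k=1,\dots,K-1$: set $A^{\{k\}}:=\mathrm{reshape}(\mathcal{A},[M_kr_{k-1},|\mathcal{A}|/(M_kr_{k-1})])$; compute a truncated SVD $U\Sigma V^*$ of $A^{\{k\}}$ keeping at most $R_{\max}$ singular values, with $r_k:=\mathrm{rank}(\Sigma)$, $1\le r_k\le R_{\max}$; set $\mathcal{A}^{(k)}:=\mathrm{reshape}(U,[r_{k-1},M_k,r_k])$; overwrite $\mathcal{A}:=\Sigma V^*$. Finally set $\mathcal{A}^{(K)}:=\mathcal{A}$. Max rank QTT-FFT (resp. QTT-iFFT): the algorithm of Dolgov, Khoromskij and Savostyanov which, given a tensor in QTT format representing a vector of length $2^K$, computes an approximation in QTT format of the discrete Fourier transform (resp. inverse discrete Fourier transform) of that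 vector, with all TT-ranks truncated to be at most $R_{\max}$. QTT convolution algorithm. Step 1: reshape the zero-padded vectors $f_\xi,g$ (length $2^K$) into $K$-mode tensors $\mathcal{F}_\xi,\mathcal{G}\in\mathbb{R}^{2\times\cdots\times2}$. Step 2: decompose $\mathcal{F}_\xi$ and $\mathcal{G}$ into QTT format by the max rank TT-SVD algorithm. Step 3: compute $\mathcal{I}=\mathrm{QTT\text{-}iFFT}(\mathrm{QTT\text{-}FFT}(\mathcal{F}_\xi)\odot\mathrm{QTT\text{-}FFT}(\mathcal{G}))$, all with max rank $R_{\max}$, where $\odot$ is the elementwise product. Step 4: recover the full vector from the TT-cores $\mathcal{I}^{(1)},\dots,\mathcal{I}^{(K)}$ of $\mathcal{I}$ (with TT-ranks $r_k\le R_{\max}$) by the "Full" algorithm: set $A:=\mathcal{I}^{(1)}$; for $k=2,\dots,K$ set $A:=\mathrm{reshape}(A,[|A|/r_{k-1},r_{k-1}])$, $B:=\mathrm{reshape}(\mathcal{I}^{(k)},[r_{k-1},2r_k])$, $A:=AB$; finally reshape $A$ to a $2\times\cdots\times2$ tensor, and then to a vector. Cost model. The SVD of an $m\times n$ matrix costs $\mathcal{O}(mn\min(m,n))$; the product of an $m\times p$ and a $p\times n$ matrix costs $\mathcal{O}(mpn)$; the cost of the max rank TT-SVD is the sum of the costs of its SVDs; the cost of the Full algorithm is the sum of the costs of its products $AB$; Step 3 is charged $\mathcal{O}(K^2R_{\max}^3)$, the known complexity of the QTT-FFT and QTT-iFFT algorithms; reshapes are not charged. $C_{\text{QTT-conv}}$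 is the total cost of Steps 1–4. *)

theory Defs
  imports
    Complex_Main
    "Jordan_Normal_Form.DL_Rank"
    "Jordan_Normal_Form.Schur_Decomposition"
begin

section \<open>Arrays in column-major order\<close>

text \<open>An array is its list of mode sizes together with its entries, listed in column-major order
  (first index fastest). Hence \<open>reshape\<close> only replaces the mode sizes. All indices are 0-based.\<close>

datatype marray = MArray (shape: "nat list") (entries: "complex vec")

definition wf_marray :: "marray \<Rightarrow> bool" where
  "wf_marray X \<longleftrightarrow> dim_vec (entries X) = prod_list (shape X)"

definition num_entries :: "marray \<Rightarrow> nat" where
  "num_entries X = dim_vec (entries X)"

definition reshape :: "marray \<Rightarrow> nat list \<Rightarrow> marray" where
  "reshape X ps = MArray ps (entries X)"

fun lin_index :: "nat list \<Rightarrow> nat list \<Rightarrow> nat" where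
  "lin_index (p # ps) (i # is) = i + p * lin_index ps is"
| "lin_index _ _ = 0"

text \<open>Inverse of \<^term>\<open>lin_index ps\<close>; for \<open>ps = [2, \<dots>, 2]\<close> it yields the binary digits,
  least significant first.\<close>

fun multi_index :: "nat list \<Rightarrow> nat \<Rightarrow> nat list" where
  "multi_index [] n = []"
| "multi_index (p # ps) n = (n mod p) # multi_index ps (n div p)"

definition entry :: "marray \<Rightarrow> nat list \<Rightarrow> complex" where
  "entry X is = entries X $ lin_index (shape X) is"

definition mat_of_marray :: "marray \<Rightarrow> complex mat" where
  "mat_of_marray X = mat (shape X ! 0) (shape X ! 1) (\<lambda>(i, j). entry X [i, j])"

definition marray_of_mat :: "complex mat \<Rightarrow> marray" where
  "marray_of_mat A = MArray [dim_row A, dim_col A]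
     (vec (dim_row A * dim_col A) (\<lambda>n. A $$ (n mod dim_row A, n div dim_row A)))"

definition hadamard :: "marray \<Rightarrow> marray \<Rightarrow> marray" where
  "hadamard X Y = MArray (shape X)
     (vec (num_entries X) (\<lambda>n. entries X $ n * entries Y $ n))"


section \<open>Tensor trains\<close>

definition tt_format :: "nat list \<Rightarrow> nat list \<Rightarrow> marray list \<Rightarrow> bool" where
  "tt_format Ms rs Gs \<longleftrightarrow>
     length Gs = length Ms \<and> length rs = length Ms + 1 \<and>
     rs ! 0 = 1 \<and> rs ! length Ms = 1 \<and> (\<forall>r \<in> set rs. 1 \<le> r) \<and>
     (\<forall>k < length Ms. wf_marray (Gs ! k) \<and> shape (Gs ! k) = [rs ! k, Ms ! k, rs ! (k + 1)])"

definition tt_slice :: "marray \<Rightarrow> nat \<Rightarrow> complex mat" where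
  "tt_slice G i = mat (shape G ! 0) (shape G ! 2) (\<lambda>(a, b). entry G [a, i, b])"

fun tt_prod :: "marray list \<Rightarrow> nat list \<Rightarrow> complex mat" where
  "tt_prod [] is = 1\<^sub>m 1"
| "tt_prod (G # Gs) is = tt_slice G (hd is) * tt_prod Gs (tl is)"

text \<open>The array represented by TT-cores.\<close>

definition tt_full :: "marray list \<Rightarrow> marray" where
  "tt_full Gs = (let Ms = map (\<lambda>G. shape G ! 1) Gs in
     MArray Ms (vec (prod_list Ms) (\<lambda>n. tt_prod Gs (multi_index Ms n) $$ (0, 0))))"

definition qtt_format :: "nat \<Rightarrow> marray list \<Rightarrow> bool" where
  "qtt_format K Gs \<longleftrightarrow> (\<exists>rs. tt_format (replicate K 2) rs Gs)"

definition qtt_format_max_rank :: "nat \<Rightarrow> nat \<Rightarrow> marray list \<Rightarrow> bool" where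
  "qtt_format_max_rank K R Gs \<longleftrightarrow>
     (\<exists>rs. tt_format (replicate K 2) rs Gs \<and> (\<forall>r \<in> set rs. r \<le> R))"

text \<open>The vector of length \<open>2^K\<close> represented by \<open>K\<close> QTT-cores.\<close>

definition qtt_vec :: "marray list \<Rightarrow> complex vec" where
  "qtt_vec Gs = entries (tt_full Gs)"


section \<open>Truncated singular value decomposition\<close>

definition unitary_mat :: "nat \<Rightarrow> complex mat \<Rightarrow> bool" where
  "unitary_mat n U \<longleftrightarrow> U \<in> carrier_mat n n \<and> mat_adjoint U * U = 1\<^sub>m n"

definition sv_mat :: "nat \<Rightarrow> nat \<Rightarrow> (nat \<Rightarrow> real) \<Rightarrow> complex mat" where
  "sv_mat m n \<sigma> = mat m n (\<lambda>(i, j). if i = j then complex_of_real (\<sigma> i) else 0)"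

definition is_svd :: "complex mat \<Rightarrow> complex mat \<Rightarrow> (nat \<Rightarrow> real) \<Rightarrow> complex mat \<Rightarrow> bool" where
  "is_svd A U \<sigma> V \<longleftrightarrow>
     unitary_mat (dim_row A) U \<and> unitary_mat (dim_col A) V \<and>
     (\<forall>i < min (dim_row A) (dim_col A). 0 \<le> \<sigma> i) \<and>
     (\<forall>i j. i \<le> j \<longrightarrow> j < min (dim_row A) (dim_col A) \<longrightarrow> \<sigma> j \<le> \<sigma> i) \<and>
     A = U * sv_mat (dim_row A) (dim_col A) \<sigma> * mat_adjoint V"

definition first_cols :: "nat \<Rightarrow> complex mat \<Rightarrow> complex mat" where
  "first_cols r U = mat (dim_row U) r (\<lambda>(i, j). U $$ (i, j))"

text \<open>The \<open>r\<close> largest singular values are kept, and \<open>r\<close> is the rank of \<open>S\<close>. The maximum with 1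
  matters only for \<open>A = 0\<close>, where the rank is 0 but a TT-rank has to be positive; then \<open>S\<close> is the
  \<open>1 \<times> 1\<close> zero matrix.\<close>

definition truncated_svd ::
  "nat \<Rightarrow> complex mat \<Rightarrow> complex mat \<Rightarrow> complex mat \<Rightarrow> complex mat \<Rightarrow> bool" where
  "truncated_svd R A U S V \<longleftrightarrow>
     (\<exists>U0 \<sigma> V0 r. is_svd A U0 \<sigma> V0 \<and> 1 \<le> r \<and> r \<le> R \<and> r \<le> min (dim_row A) (dim_col A) \<and>
        U = first_cols r U0 \<and> S = sv_mat r r \<sigma> \<and> V = first_cols r V0 \<and>
        r = max 1 (vec_space.rank r S))"


section \<open>Max rank TT-SVD\<close>

text \<open>\<open>tt_svd svd_cost R r X Ms Gs c\<close>: started with previous TT-rank \<open>r\<close> and current array \<open>X\<close>, the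
  loop over the remaining modes \<open>Ms\<close> may produce the remaining cores \<open>Gs\<close> at cost \<open>c\<close>. It is a
  relation because a truncated SVD is not unique. The charge for the SVD of an \<open>m \<times> n\<close> matrix is
  \<open>svd_cost m n\<close>.\<close>

inductive tt_svd ::
  "(nat \<Rightarrow> nat \<Rightarrow> real) \<Rightarrow> nat \<Rightarrow> nat \<Rightarrow> marray \<Rightarrow> nat list \<Rightarrow> marray list \<Rightarrow> real \<Rightarrow> bool"
  for svd_cost :: "nat \<Rightarrow> nat \<Rightarrow> real" and R :: nat where
  last: "tt_svd svd_cost R r X [M] [reshape X [r, M, 1]] 0"
| step: "Ms \<noteq> [] \<Longrightarrow>
     A = mat_of_marray (reshape X [M * r, num_entries X div (M * r)]) \<Longrightarrow>
     truncated_svd R A U S V \<Longrightarrow>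
     r' = dim_row S \<Longrightarrow>
     tt_svd svd_cost R r' (marray_of_mat (S * mat_adjoint V)) Ms Gs c \<Longrightarrow>
     tt_svd svd_cost R r X (M # Ms) (reshape (marray_of_mat U) [r, M, r'] # Gs)
       (svd_cost (dim_row A) (dim_col A) + c)"

definition max_rank_tt_svd ::
  "(nat \<Rightarrow> nat \<Rightarrow> real) \<Rightarrow> nat \<Rightarrow> marray \<Rightarrow> marray list \<Rightarrow> real \<Rightarrow> bool" where
  "max_rank_tt_svd svd_cost R X Gs c \<longleftrightarrow> tt_svd svd_cost R 1 X (shape X) Gs c"


section \<open>The Full algorithm\<close>

text \<open>Returns the final array and the total charge, where the product of an \<open>m \<times> p\<close> and a
  \<open>p \<times> n\<close> matrix is charged \<open>mult_cost m p n\<close>.\<close>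

fun full_loop ::
  "(nat \<Rightarrow> nat \<Rightarrow> nat \<Rightarrow> real) \<Rightarrow> marray \<Rightarrow> marray list \<Rightarrow> marray \<times> real" where
  "full_loop mult_cost X [] = (X, 0)"
| "full_loop mult_cost X (G # Gs) =
     (let r = shape G ! 0; r' = shape G ! 2;
          A = mat_of_marray (reshape X [num_entries X div r, r]);
          B = mat_of_marray (reshape G [r, 2 * r']);
          (Y, c) = full_loop mult_cost (marray_of_mat (A * B)) Gs
      in (Y, mult_cost (dim_row A) (dim_col A) (dim_col B) + c))"

definition full_alg ::
  "(nat \<Rightarrow> nat \<Rightarrow> nat \<Rightarrow> real) \<Rightarrow> marray list \<Rightarrow> complex vec \<times> real" where
  "full_alg mult_cost Gs =
     (let (Y, c) = full_loop mult_cost (hd Gs) (tl Gs)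
      in (entries (reshape (reshape Y (replicate (length Gs) 2)) [2 ^ length Gs]), c))"


section \<open>Max rank QTT-FFT and QTT-iFFT\<close>

definition dft :: "complex vec \<Rightarrow> complex vec" where
  "dft v = vec (dim_vec v) (\<lambda>k. \<Sum>j < dim_vec v.
     v $ j * cis (- 2 * pi * real j * real k / real (dim_vec v)))"

definition idft :: "complex vec \<Rightarrow> complex vec" where
  "idft v = vec (dim_vec v) (\<lambda>k. (\<Sum>j < dim_vec v.
     v $ j * cis (2 * pi * real j * real k / real (dim_vec v))) / of_nat (dim_vec v))"

definition l2_dist :: "complex vec \<Rightarrow> complex vec \<Rightarrow> real" where
  "l2_dist v w = sqrt (\<Sum>i < dim_vec v. (cmod (v $ i - w $ i))\<^sup>2)"

text \<open>\<open>alg R\<close> maps a QTT representation of a vector to a QTT representation, with all TT-ranks at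
  most \<open>R\<close>, of an approximation of the transform \<open>T\<close> of that vector. Rank truncation gives no
  a priori accuracy, so the error \<open>err R Gs\<close> may depend arbitrarily on the rank bound and the
  input.\<close>

definition max_rank_qtt_transform ::
  "(complex vec \<Rightarrow> complex vec) \<Rightarrow> (nat \<Rightarrow> marray list \<Rightarrow> real) \<Rightarrow>
   (nat \<Rightarrow> marray list \<Rightarrow> marray list) \<Rightarrow> bool" where
  "max_rank_qtt_transform T err alg \<longleftrightarrow>
     (\<forall>R \<ge> 1. \<forall>K \<ge> 1. \<forall>Gs. qtt_format K Gs \<longrightarrow>
        qtt_format_max_rank K R (alg R Gs) \<and>
        l2_dist (qtt_vec (alg R Gs)) (T (qtt_vec Gs)) \<le> err R Gs)"


section \<open>The QTT convolution algorithm\<close>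

definition zero_pad :: "nat \<Rightarrow> real vec \<Rightarrow> complex vec" where
  "zero_pad n v = vec n (\<lambda>i. if i < dim_vec v then complex_of_real (v $ i) else 0)"

definition quantize :: "nat \<Rightarrow> complex vec \<Rightarrow> marray" where
  "quantize K v = reshape (MArray [dim_vec v] v) (replicate K 2)"

text \<open>\<open>qtt_conv \<dots> K R f g y C\<close>: on input \<open>f, g\<close> the algorithm with max rank \<open>R\<close> may return the
  vector \<open>y\<close> at total cost \<open>C\<close>. The cores \<open>Hs\<close> are any QTT representation of the elementwise
  product (such as the usual one by Kronecker products of cores); its ranks may exceed \<open>R\<close>, and
  reducing them is part of the max rank QTT-iFFT.\<close>

definition qtt_conv ::
  "(nat \<Rightarrow> nat \<Rightarrow> real) \<Rightarrow> (nat \<Rightarrow> nat \<Rightarrow> nat \<Rightarrow> real) \<Rightarrow> (nat \<Rightarrow> nat \<Rightarrow> real) \<Rightarrow>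
   (nat \<Rightarrow> marray list \<Rightarrow> marray list) \<Rightarrow> (nat \<Rightarrow> marray list \<Rightarrow> marray list) \<Rightarrow>
   nat \<Rightarrow> nat \<Rightarrow> real vec \<Rightarrow> real vec \<Rightarrow> complex vec \<Rightarrow> real \<Rightarrow> bool" where
  "qtt_conv svd_cost mult_cost fft_cost qtt_fft qtt_ifft K R f g y C \<longleftrightarrow>
     (\<exists>Fs Gs Hs c\<^sub>F c\<^sub>G c\<^sub>I.
        max_rank_tt_svd svd_cost R (quantize K (zero_pad (2 ^ K) f)) Fs c\<^sub>F \<and>
        max_rank_tt_svd svd_cost R (quantize K (zero_pad (2 ^ K) g)) Gs c\<^sub>G \<and>
        qtt_format K Hs \<and>
        tt_full Hs = hadamard (tt_full (qtt_fft R Fs)) (tt_full (qtt_fft R Gs)) \<and>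
        full_alg mult_cost (qtt_ifft R Hs) = (y, c\<^sub>I) \<and>
        C = c\<^sub>F + c\<^sub>G + fft_cost K R + c\<^sub>I)"

end

theory Submission
  imports Defs "HOL-Real_Asymp.Real_Asymp"
begin

text \<open>The rank bound keeps one side of every matrix short, so the cost is governed by the lengths
  of the arrays involved, and these form geometric progressions. In the TT-SVD
  every iteration splits off one mode and replaces it by a rank at most \<open>R\<close>: with \<open>L\<close> modes left,
  an array of \<open>r * 2 ^ L\<close> entries with \<open>r \<le> R\<close> is unfolded into a matrix with only \<open>2 * r\<close> rows.
  The number of rows bounds the minimum in the price of the SVD, which is therefore of order
  \<open>R\<^sup>2 * 2 ^ L\<close>, and summing over \<open>L \<le> K\<close> costs only a factor 2 (\<open>tt_svd_cost_le\<close>). The Full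
  algorithm runs through such a progression upwards: each product doubles the number of rows, so
  the last one dominates (\<open>full_loop_cost_le\<close>). Both bounds hold for every \<open>K \<ge> 1\<close>.

  The arithmetic in the QTT format is charged \<open>K\<^sup>2 * R ^ 3\<close>. Its extra factor \<open>R\<close> is the only
  reason why the constant can be independent of \<open>R\<close> only for large \<open>K\<close>: once
  \<open>K\<^sup>2 * R\<close> is small against \<open>2 ^ K\<close>, this charge is absorbed into \<open>R\<^sup>2 * 2 ^ K\<close>
  (\<open>eventually_fft_charge_le\<close>).

  The Full algorithm is applied to the output of the max rank QTT-iFFT, whose ranks are at most
  \<open>R\<close> by specification, however large the ranks of the elementwise product are.\<close>

section \<open>Cost of the TT-SVD\<close>

lemma truncated_svd_dims:
  assumes "truncated_svd R A U S V"
  shows "1 \<le> dim_row S" "dim_row S \<le> R" "dim_row V = dim_col A"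
  using assms
  by (auto simp: truncated_svd_def is_svd_def unitary_mat_def sv_mat_def first_cols_def)

lemma num_entries_marray_of_mat: "num_entries (marray_of_mat A) = dim_row A * dim_col A"
  by (simp add: num_entries_def marray_of_mat_def)

lemma dim_mat_of_marray_reshape:
  "dim_row (mat_of_marray (reshape X [m, n])) = m"
  "dim_col (mat_of_marray (reshape X [m, n])) = n"
  by (simp_all add: mat_of_marray_def reshape_def)

text \<open>The truncated factor \<open>S * V\<^sup>*\<close> has \<open>r'\<close> rows and keeps the columns of the unfolding, so the
  entry count \<open>r * 2 ^ L\<close> is an invariant of the loop. Bounding the minimum by the number
  \<open>2 * r\<close> of rows prices the SVD at \<open>4 * r\<^sup>2 * 2 ^ (L - 1)\<close>; adding the same bound for the
  remaining \<open>L - 1\<close> modes doubles it.\<close>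

lemma tt_svd_cost_le:
  assumes cost: "\<forall>m\<ge>1. \<forall>n\<ge>1. svd_cost m n \<le> a * real (m * n * min m n)" and "0 \<le> a"
    and "tt_svd svd_cost R r X (replicate L 2) Gs c"
    and "num_entries X = r * 2 ^ L" and "1 \<le> r" and "r \<le> R"
  shows "c \<le> 4 * a * (real R ^ 2 * 2 ^ L)"
  using assms(3-)
proof (induction r X "replicate L (2::nat)" Gs c arbitrary: L rule: tt_svd.induct)
  case (last r X M)
  show ?case using \<open>0 \<le> a\<close> by simp
next
  case (step Ms A X M r U S V r' Gs c)
  obtain l where L: "L = Suc l" using step.hyps(7) by (cases L) auto
  with step.hyps(7) have M: "M = 2" and Ms: "Ms = replicate l 2" by auto
  have "num_entries X div (M * r) = 2 ^ l"
    using step.prems M L by simp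
  with step.hyps(2) M have A: "dim_row A = 2 * r" "dim_col A = 2 ^ l"
    by (simp_all add: dim_mat_of_marray_reshape)
  have "num_entries (marray_of_mat (S * mat_adjoint V)) = r' * 2 ^ l"
    using truncated_svd_dims(3)[OF step.hyps(3)] A step.hyps(4)
    by (simp add: num_entries_marray_of_mat mat_adjoint_def)
  with truncated_svd_dims(1,2)[OF step.hyps(3)] have rest: "c \<le> 4 * a * (real R ^ 2 * 2 ^ l)"
    using step.hyps(4) Ms by (intro step.hyps(6)) auto
  have "svd_cost (2 * r) (2 ^ l) \<le> a * real (2 * r * 2 ^ l * min (2 * r) (2 ^ l))"
    using cost[rule_format, of "2 * r" "2 ^ l"] step.prems(2) by simp
  also have "\<dots> \<le> a * real (2 * r * 2 ^ l * (2 * r))"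
    using \<open>0 \<le> a\<close> by (intro mult_left_mono of_nat_mono) auto
  also have "\<dots> = 4 * a * (real r ^ 2 * 2 ^ l)"
    by (simp add: power2_eq_square)
  also have "\<dots> \<le> 4 * a * (real R ^ 2 * 2 ^ l)"
    using \<open>0 \<le> a\<close> step.prems(3) by (intro mult_left_mono mult_right_mono power_mono) auto
  finally have "svd_cost (2 * r) (2 ^ l) \<le> 4 * a * (real R ^ 2 * 2 ^ l)" .
  with rest show ?case by (simp add: A L algebra_simps)
qed

corollary max_rank_tt_svd_quantize_cost_le:
  assumes "\<forall>m\<ge>1. \<forall>n\<ge>1. svd_cost m n \<le> a * real (m * n * min m n)" and "0 \<le> a"
    and "max_rank_tt_svd svd_cost R (quantize K v) Gs c"
    and "dim_vec v = 2 ^ K" and "1 \<le> R"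
  shows "c \<le> 4 * a * (real R ^ 2 * 2 ^ K)"
proof (rule tt_svd_cost_le[OF assms(1,2)])
  show "tt_svd svd_cost R 1 (quantize K v) (replicate K 2) Gs c"
    using assms(3) by (simp add: max_rank_tt_svd_def quantize_def reshape_def)
qed (use assms(4,5) in \<open>auto simp: quantize_def reshape_def num_entries_def\<close>)


section \<open>Cost of the Full algorithm\<close>

text \<open>If the current array has \<open>m\<close> rows, the next product costs at most \<open>2 * m * R\<^sup>2\<close> and leaves an
  array of \<open>2 * m\<close> rows; for \<open>L\<close> remaining cores the geometric sum is
  \<open>2 * m * R\<^sup>2 * (2 ^ L - 1)\<close>.\<close>

lemma full_loop_cost_le:
  assumes cost: "\<forall>m\<ge>1. \<forall>p\<ge>1. \<forall>n\<ge>1. mult_cost m p n \<le> a * real (m * p * n)" and "0 \<le> a"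
    and "length rs = length Gs + 1" and "\<forall>k < length Gs. shape (Gs ! k) = [rs ! k, 2, rs ! (k + 1)]"
    and "\<forall>r \<in> set rs. 1 \<le> r \<and> r \<le> R"
    and "num_entries X = m * rs ! 0" and "1 \<le> m"
  shows "snd (full_loop mult_cost X Gs) \<le> 2 * a * (real R ^ 2 * real m * (2 ^ length Gs - 1))"
  using assms(3-)
proof (induction Gs arbitrary: rs X m)
  case Nil
  show ?case by simp
next
  case (Cons G Gs)
  obtain r r' qs where rs: "rs = r # r' # qs"
    using Cons.prems(1) by (cases rs; cases "tl rs") auto
  have G: "shape G = [r, 2, r']"
    using Cons.prems(2) rs by auto
  have r: "1 \<le> r" "r \<le> R" and r': "1 \<le> r'" "r' \<le> R"
    using Cons.prems(3) rs by auto
  define A where "A = mat_of_marray (reshape X [num_entries X div r, r])"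
  define B where "B = mat_of_marray (reshape G [r, 2 * r'])"
  have dims: "dim_row A = m" "dim_col A = r" "dim_col B = 2 * r'"
    using Cons.prems(4) rs r by (simp_all add: A_def B_def dim_mat_of_marray_reshape)
  have loop: "snd (full_loop mult_cost X (G # Gs))
      = mult_cost m r (2 * r') + snd (full_loop mult_cost (marray_of_mat (A * B)) Gs)"
    using G dims by (simp add: Let_def split_beta A_def[symmetric] B_def[symmetric])
  have rest: "snd (full_loop mult_cost (marray_of_mat (A * B)) Gs)
      \<le> 2 * a * (real R ^ 2 * real (2 * m) * (2 ^ length Gs - 1))"
  proof (rule Cons.IH)
    show "length (r' # qs) = length Gs + 1" using Cons.prems(1) rs by simp
    show "\<forall>k < length Gs. shape (Gs ! k) = [(r' # qs) ! k, 2, (r' # qs) ! (k + 1)]"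
      using Cons.prems(2) rs by fastforce
    show "\<forall>r \<in> set (r' # qs). 1 \<le> r \<and> r \<le> R" using Cons.prems(3) rs by auto
    show "num_entries (marray_of_mat (A * B)) = 2 * m * (r' # qs) ! 0"
      by (simp add: num_entries_marray_of_mat dims)
    show "1 \<le> 2 * m" using Cons.prems(5) by simp
  qed
  have "mult_cost m r (2 * r') \<le> a * real (m * r * (2 * r'))"
    using cost[rule_format, of m r "2 * r'"] Cons.prems(5) r(1) r'(1) by linarith
  also have "\<dots> \<le> a * real (m * R * (2 * R))"
    using \<open>0 \<le> a\<close> r(2) r'(2) by (intro mult_left_mono of_nat_mono mult_mono) auto
  finally have "mult_cost m r (2 * r') \<le> 2 * a * (real R ^ 2 * real m)"
    by (simp add: power2_eq_square algebra_simps)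
  with rest show ?case unfolding loop by (simp add: algebra_simps)
qed

text \<open>The first core has TT-rank 1 on its left, so the loop starts with an array of 2 rows and the
  remaining \<open>K - 1\<close> cores.\<close>

corollary full_alg_cost_le:
  assumes cost: "\<forall>m\<ge>1. \<forall>p\<ge>1. \<forall>n\<ge>1. mult_cost m p n \<le> a * real (m * p * n)" and "0 \<le> a"
    and "qtt_format_max_rank K R Gs" and "1 \<le> K"
  shows "snd (full_alg mult_cost Gs) \<le> 2 * a * (real R ^ 2 * 2 ^ K)"
proof -
  obtain rs where len: "length Gs = K" "length rs = K + 1" and "rs ! 0 = 1"
    and cores: "\<And>k. k < K \<Longrightarrow> wf_marray (Gs ! k) \<and> shape (Gs ! k) = [rs ! k, 2, rs ! (k + 1)]"
    and ranks: "\<forall>r \<in> set rs. 1 \<le> r \<and> r \<le> R"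
    using assms(3) by (auto simp: qtt_format_max_rank_def tt_format_def)
  obtain G Gs' where Gs: "Gs = G # Gs'" using len(1) \<open>1 \<le> K\<close> by (cases Gs) auto
  obtain q qs where rs: "rs = q # qs" using len(2) by (cases rs) auto
  have "num_entries G = 2 * qs ! 0"
    using cores[of 0] \<open>1 \<le> K\<close> \<open>rs ! 0 = 1\<close> by (auto simp: Gs rs wf_marray_def num_entries_def)
  moreover have "\<forall>k < length Gs'. shape (Gs' ! k) = [qs ! k, 2, qs ! (k + 1)]"
  proof (intro allI impI)
    fix k assume "k < length Gs'"
    then show "shape (Gs' ! k) = [qs ! k, 2, qs ! (k + 1)]"
      using cores[of "Suc k"] len(1) by (simp add: Gs rs)
  qed
  ultimately have "snd (full_loop mult_cost G Gs')
      \<le> 2 * a * (real R ^ 2 * real 2 * (2 ^ length Gs' - 1))"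
    using len ranks by (intro full_loop_cost_le[OF assms(1,2), where rs = qs]) (auto simp: Gs rs)
  also have "\<dots> \<le> 2 * a * (real R ^ 2 * 2 ^ K)"
    using len(1) \<open>0 \<le> a\<close> by (intro mult_left_mono) (auto simp: Gs algebra_simps)
  finally show ?thesis by (simp add: full_alg_def Gs Let_def split_beta)
qed


section \<open>Total cost\<close>

lemma eventually_fft_charge_le:
  fixes a :: real
  shows "\<forall>\<^sub>F K in sequentially. a * (real K ^ 2 * real R ^ 3) \<le> real R ^ 2 * 2 ^ K"
proof -
  have "(\<lambda>K. real K ^ 2 / 2 ^ K) \<longlonglongrightarrow> 0" by real_asymp
  then have "(\<lambda>K. a * real R * (real K ^ 2 / 2 ^ K)) \<longlonglongrightarrow> 0"
    by (rule tendsto_mult_right_zero)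
  then have "\<forall>\<^sub>F K in sequentially. a * real R * (real K ^ 2 / 2 ^ K) < 1"
    by (rule order_tendstoD) simp
  then show ?thesis
  proof eventually_elim
    case (elim K)
    then have "a * real R * real K ^ 2 \<le> 2 ^ K" by (simp add: field_simps)
    then have "real R ^ 2 * (a * real R * real K ^ 2) \<le> real R ^ 2 * 2 ^ K"
      by (intro mult_left_mono) auto
    then show ?case by (simp add: power2_eq_square power3_eq_cube algebra_simps)
  qed
qed

text \<open>The constants hidden in the cost model may be negative, since the cost functions are arbitrary
  real functions. Monotonicity in the rank and in the minimum needs a nonnegative constant.\<close>

lemma cost_le_max_0:
  fixes x :: "'a :: linordered_semidom"
  assumes "x \<le> c * y" and "0 \<le> y"
  shows "x \<le> max c 0 * y"
  using assms by (meson max.cobounded1 mult_right_mono order_trans)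

theorem theorem5p2:
  fixes svd_cost :: "nat \<Rightarrow> nat \<Rightarrow> real"
    and mult_cost :: "nat \<Rightarrow> nat \<Rightarrow> nat \<Rightarrow> real"
    and fft_cost :: "nat \<Rightarrow> nat \<Rightarrow> real"
    and qtt_fft qtt_ifft :: "nat \<Rightarrow> marray list \<Rightarrow> marray list"
    and err_fft err_ifft :: "nat \<Rightarrow> marray list \<Rightarrow> real"
  assumes svd_cost: "\<exists>c. \<forall>m\<ge>1. \<forall>n\<ge>1. svd_cost m n \<le> c * real (m * n * min m n)"
    and mult_cost: "\<exists>c. \<forall>m\<ge>1. \<forall>p\<ge>1. \<forall>n\<ge>1. mult_cost m p n \<le> c * real (m * p * n)"
    and fft_cost: "\<exists>c. \<forall>K\<ge>1. \<forall>R\<ge>1. fft_cost K R \<le> c * (real K ^ 2 * real R ^ 3)"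
    and qtt_fft: "max_rank_qtt_transform dft err_fft qtt_fft"
    and qtt_ifft: "max_rank_qtt_transform idft err_ifft qtt_ifft"
  shows "\<exists>C>0. \<forall>R\<ge>1. \<forall>\<^sub>F K in sequentially.
    \<forall>f \<in> carrier_vec (2 ^ (K - 1) - 1). \<forall>g \<in> carrier_vec (2 ^ (K - 1) - 1). \<forall>y cost.
      qtt_conv svd_cost mult_cost fft_cost qtt_fft qtt_ifft K R f g y cost \<longrightarrow>
      cost \<le> C * (real R ^ 2 * 2 ^ K)"
proof -
  obtain a where "\<forall>m\<ge>1. \<forall>n\<ge>1. svd_cost m n \<le> a * real (m * n * min m n)"
    using svd_cost by blast
  then have a: "\<forall>m\<ge>1. \<forall>n\<ge>1. svd_cost m n \<le> max a 0 * real (m * n * min m n)"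
    using cost_le_max_0 by (metis of_nat_0_le_iff)
  obtain b where "\<forall>m\<ge>1. \<forall>p\<ge>1. \<forall>n\<ge>1. mult_cost m p n \<le> b * real (m * p * n)"
    using mult_cost by blast
  then have b: "\<forall>m\<ge>1. \<forall>p\<ge>1. \<forall>n\<ge>1. mult_cost m p n \<le> max b 0 * real (m * p * n)"
    using cost_le_max_0 by (metis of_nat_0_le_iff)
  obtain c where c: "\<forall>K\<ge>1. \<forall>R\<ge>1. fft_cost K R \<le> c * (real K ^ 2 * real R ^ 3)"
    using fft_cost by blast
  \<comment> \<open>Two decompositions, the arithmetic in the QTT format, and the recovery of the vector.\<close>
  define C where "C = 2 * (4 * max a 0) + 1 + 2 * max b 0"
  have "\<forall>\<^sub>F K in sequentially. \<forall>f g y cost.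
      qtt_conv svd_cost mult_cost fft_cost qtt_fft qtt_ifft K R f g y cost \<longrightarrow>
      cost \<le> C * (real R ^ 2 * 2 ^ K)" if R: "1 \<le> R" for R
    using eventually_fft_charge_le[of c R] eventually_ge_at_top[of "1::nat"]
  proof eventually_elim
    case (elim K)
    show ?case
    proof (intro allI impI)
      fix f g y cost
      assume "qtt_conv svd_cost mult_cost fft_cost qtt_fft qtt_ifft K R f g y cost"
      then obtain Fs Gs Hs cF cG cI where
        F: "max_rank_tt_svd svd_cost R (quantize K (zero_pad (2 ^ K) f)) Fs cF" and
        G: "max_rank_tt_svd svd_cost R (quantize K (zero_pad (2 ^ K) g)) Gs cG" and
        H: "qtt_format K Hs" and
        I: "full_alg mult_cost (qtt_ifft R Hs) = (y, cI)" and
        cost: "cost = cF + cG + fft_cost K R + cI"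
        unfolding qtt_conv_def by blast
      have pad: "dim_vec (zero_pad (2 ^ K) v) = 2 ^ K" for v
        by (simp add: zero_pad_def)
      have "cF \<le> 4 * max a 0 * (real R ^ 2 * 2 ^ K)"
        by (rule max_rank_tt_svd_quantize_cost_le[OF a _ F pad R]) simp
      moreover have "cG \<le> 4 * max a 0 * (real R ^ 2 * 2 ^ K)"
        by (rule max_rank_tt_svd_quantize_cost_le[OF a _ G pad R]) simp
      moreover have "fft_cost K R \<le> real R ^ 2 * 2 ^ K"
        using c elim R by (meson order_trans)
      moreover have "qtt_format_max_rank K R (qtt_ifft R Hs)"
        using qtt_ifft H R elim(2) unfolding max_rank_qtt_transform_def by blast
      then have "cI \<le> 2 * max b 0 * (real R ^ 2 * 2 ^ K)"
        using full_alg_cost_le[OF b _ _ elim(2)] I by (metis max.cobounded2 snd_conv)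
      ultimately show "cost \<le> C * (real R ^ 2 * 2 ^ K)"
        unfolding cost C_def distrib_right by simp
    qed
  qed
  moreover have "C > 0" unfolding C_def by simp
  ultimately show ?thesis
    by (intro exI[of _ C] conjI allI impI ballI) (assumption, rule eventually_mono, blast+)
qed

end
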